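(* Consider a particle in the plane with dimensionless canonical observables $x,y,p_x,p_y$ ($[x,p_x]=[y,p_y]=i$, other commutators zero) and Hamiltonian $H(t)=\tfrac12\big(p_x^2+p_y^2+\beta(t)^2(x^2+y^2)\big)-\beta(t)M_z$, $M_z=xp_y-yp_x$, where $\beta:\mathbb R\to\mathbb R$ is piecewise continuous, periodic with period $1$, satisfies $\beta(k)=0$ for all $k\in\mathbb Z$, and $\int_0^1\beta(t)\,dt=0$. Let $u(t)$ be the $4\times4$ evolution matrix, $(x(t),y(t),p_x(t),p_y(t))^T=u(t)(x,y,p_x,p_y)^T$ for the classical or Heisenberg variables. Suppose the evolution is a loop that closes for the first time after $n>1$ periods, i.e. $u(n)=\mathbb 1$ and $u(j)\neq\mathbb 1$ for $j=1,\dots,n-1$. Then the loop center $\mathbf X=\frac1n\int_0^n(x(t),y(t))\,dt$ vanishes identically.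
   Context: Time is dimensionless (period of $\beta$ equal to $1$), $\hbar=1$, unit mass. The Hamiltonian is quadratic, so the classical and Heisenberg trajectories are given by the same real matrix $u(t)$. *)

theory Defs
  imports "HOL-Analysis.Analysis"
begin

text \<open>Piecewise continuity of a real function on the real line: on every compact
  interval there are only finitely many discontinuities, and at each of them
  both one-sided limits exist (and are finite).\<close>
definition piecewise_continuous :: "(real \<Rightarrow> real) \<Rightarrow> bool" where
  "piecewise_continuous f \<longleftrightarrow>
     (\<forall>a b. \<exists>S. finite S \<and> (\<forall>x\<in>{a..b} - S. isCont f x) \<and>
        (\<forall>s\<in>S. (\<exists>l. (f \<longlongrightarrow> l) (at_left s)) \<and> (\<exists>l. (f \<longlongrightarrow> l) (at_right s))))"

text \<open>Coefficient matrix of the linear Hamiltonian equations for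
  H = 1/2 (px^2 + py^2 + beta^2 (x^2+y^2)) - beta (x py - y px), state (x, y, px, py):
  x' = px + beta y, y' = py - beta x, px' = -beta^2 x + beta py, py' = -beta^2 y - beta px.\<close>
definition ham_matrix :: "real \<Rightarrow> real^4^4" where
  "ham_matrix b = vector [vector [0, b, 1, 0],
                          vector [-b, 0, 0, 1],
                          vector [-(b^2), 0, 0, b],
                          vector [0, -(b^2), -b, 0]]"

text \<open>u is the evolution matrix: u(0) = 1 and u' = A(t) u in the Caratheodory
  (integral) sense, which is the appropriate notion for piecewise continuous beta.\<close>
definition is_evolution :: "(real \<Rightarrow> real) \<Rightarrow> (real \<Rightarrow> real^4^4) \<Rightarrow> bool" where
  "is_evolution \<beta> u \<longleftrightarrow>
     (\<forall>t\<ge>0. ((\<lambda>s. ham_matrix (\<beta> s) ** u s) has_integral (u t - mat 1)) {0..t})"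

end

theory Submission
  imports Defs
begin

text \<open>
  In the coordinates \<open>z = x + i y\<close>, \<open>p = p\<^sub>x + i p\<^sub>y\<close> the flow is complex-linear, and in the
  frame rotating by \<open>\<theta>(t) = \<integral>\<^sub>0\<^sup>t \<beta>\<close> the equations become \<open>Z'' = -\<beta>\<^sup>2 Z\<close>, whose Wronskian is
  constant. Since \<open>\<theta>(1) = 0\<close>, the monodromy \<open>U = u(1)\<close> is a complex \<open>2 \<times> 2\<close> matrix of
  determinant 1. By periodicity \<open>u(t + k) = u(t) U\<^sup>k\<close>, so the integral over \<open>n\<close> periods of the
  trajectory of \<open>v\<close> is the integral over one period of the trajectory of
  \<open>s = v + U v + \<dots> + U\<^sup>n\<^sup>-\<^sup>1 v\<close>, and \<open>U s = s\<close>. If \<open>s \<noteq> 0\<close>, the eigenvalue 1 together with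
  \<open>det U = 1\<close> makes \<open>U\<close> unipotent, and a unipotent \<open>U\<close> with \<open>U\<^sup>n = 1\<close> is the identity,
  contradicting \<open>u(1) \<noteq> 1\<close>. Hence \<open>s = 0\<close>.
\<close>

section \<open>Uniqueness for linear integral equations\<close>

lemma integral_equation_unique_zero:
  fixes y g :: "real \<Rightarrow> 'a::euclidean_space"
  assumes y_eq: "\<And>t. t \<in> {0..T} \<Longrightarrow> (g has_integral y t) {0..t}"
    and g_le: "\<And>s. s \<in> {0..T} \<Longrightarrow> norm (g s) \<le> K * norm (y s)"
    and K: "K \<ge> 0" and T: "T \<ge> 0"
  shows "y T = 0"
proof -
  have y_integral: "y t = integral {0..t} g" if "t \<in> {0..T}" for t
    using y_eq[OF that] by (rule integral_unique[symmetric])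
  have "g integrable_on {0..T}"
    using y_eq T by auto
  then have "continuous_on {0..T} y"
    using indefinite_integral_continuous_1 continuous_on_cong y_integral by (metis (no_types, lifting))
  then have "bounded (y ` {0..T})"
    by (simp add: compact_continuous_image compact_imp_bounded)
  then obtain m where m: "\<And>s. s \<in> {0..T} \<Longrightarrow> norm (y s) \<le> m"
    unfolding bounded_iff by blast
  have picard: "norm (y s) \<le> m / fact k * (K * s) ^ k" if "s \<in> {0..T}" for k s
    using that
  proof (induction k arbitrary: s)
    case 0
    then show ?case using m by simp
  next
    case (Suc k)
    let ?b = "\<lambda>r. K * (m / fact k * (K * r) ^ k)"
    have "((\<lambda>r. m / fact (Suc k) * (K * r) ^ Suc k) has_real_derivative ?b r) (at r within {0..s})" for r
      by (rule derivative_eq_intros refl)+ (simp add: fact_Suc del: of_nat_Suc)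
    then have b_integral: "(?b has_integral m / fact (Suc k) * (K * s) ^ Suc k) {0..s}"
      using fundamental_theorem_of_calculus[of 0 s "\<lambda>r. m / fact (Suc k) * (K * r) ^ Suc k" ?b] Suc.prems
      by (simp add: has_real_derivative_iff_has_vector_derivative)
    have "norm (y s) = norm (integral {0..s} g)"
      using y_integral Suc.prems by simp
    also have "\<dots> \<le> integral {0..s} ?b"
    proof (rule integral_norm_bound_integral)
      show "g integrable_on {0..s}" "?b integrable_on {0..s}"
        using y_eq Suc.prems b_integral by blast+
      show "norm (g r) \<le> ?b r" if "r \<in> {0..s}" for r
        using g_le[of r] Suc.IH[of r] that Suc.prems K
        by (meson atLeastAtMost_iff mult_left_mono order.trans)
    qed
    also have "\<dots> = m / fact (Suc k) * (K * s) ^ Suc k"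
      using b_integral by (rule integral_unique)
    finally show ?case .
  qed
  have "(\<lambda>k. m * ((K * T) ^ k / fact k)) \<longlonglongrightarrow> m * 0"
    using summable_LIMSEQ_zero[OF summable_exp[of "K * T"]]
    by (intro tendsto_mult_left) (simp add: field_simps)
  then have "norm (y T) \<le> 0"
    using picard T by (intro tendsto_le[OF _ _ tendsto_const]) auto
  then show ?thesis by simp
qed

section \<open>Piecewise continuous functions\<close>

lemma piecewise_continuous_locally_bounded:
  assumes "piecewise_continuous f"
  shows "\<exists>d>0. \<exists>B. \<forall>y. \<bar>y - x\<bar> < d \<longrightarrow> \<bar>f y\<bar> \<le> B"
proof -
  obtain S where S: "\<forall>s\<in>{x..x} - S. isCont f s"
    "\<forall>s\<in>S. (\<exists>l. (f \<longlongrightarrow> l) (at_left s)) \<and> (\<exists>l. (f \<longlongrightarrow> l) (at_right s))"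
    using assms unfolding piecewise_continuous_def by blast
  obtain l1 l2 where l1: "(f \<longlongrightarrow> l1) (at_left x)" and l2: "(f \<longlongrightarrow> l2) (at_right x)"
    using S by (cases "x \<in> S") (auto simp: isCont_def filterlim_at_split)
  define B where "B = max \<bar>f x\<bar> (max \<bar>l1\<bar> \<bar>l2\<bar> + 1)"
  have "eventually (\<lambda>y. \<bar>f y\<bar> < max \<bar>l1\<bar> \<bar>l2\<bar> + 1) (at_left x)"
    using order_tendstoD(2)[OF tendsto_rabs[OF l1], of "max \<bar>l1\<bar> \<bar>l2\<bar> + 1"] by simp
  moreover have "eventually (\<lambda>y. \<bar>f y\<bar> < max \<bar>l1\<bar> \<bar>l2\<bar> + 1) (at_right x)"
    using order_tendstoD(2)[OF tendsto_rabs[OF l2], of "max \<bar>l1\<bar> \<bar>l2\<bar> + 1"] by simp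
  ultimately have "eventually (\<lambda>y. \<bar>f y\<bar> < max \<bar>l1\<bar> \<bar>l2\<bar> + 1) (at x)"
    by (simp add: eventually_at_split)
  then obtain d where d: "d > 0"
    and near: "\<And>y. y \<noteq> x \<Longrightarrow> dist y x < d \<Longrightarrow> \<bar>f y\<bar> < max \<bar>l1\<bar> \<bar>l2\<bar> + 1"
    unfolding eventually_at by auto
  have "\<bar>f y\<bar> \<le> B" if "\<bar>y - x\<bar> < d" for y
    using near[of y] that unfolding B_def dist_real_def by (cases "y = x") (simp_all add: le_max_iff_disj)
  with d show ?thesis by blast
qed

lemma piecewise_continuous_bounded_on:
  assumes "piecewise_continuous f"
  obtains B where "\<And>x. x \<in> {a..b} \<Longrightarrow> \<bar>f x\<bar> \<le> B"
proof -
  obtain d B where dB: "\<And>x. d x > 0" "\<And>x y. \<bar>y - x\<bar> < d x \<Longrightarrow> \<bar>f y\<bar> \<le> B x"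
    using piecewise_continuous_locally_bounded[OF assms] by metis
  have cover: "{a..b} \<subseteq> (\<Union>x\<in>{a..b}. ball x (d x))"
    using dB(1) by force
  obtain T where T: "T \<subseteq> {a..b}" "finite T" "{a..b} \<subseteq> (\<Union>x\<in>T. ball x (d x))"
    using compactE_image[OF compact_Icc _ cover] by blast
  show ?thesis
  proof (rule that)
    fix y assume "y \<in> {a..b}"
    then obtain x where "x \<in> T" "\<bar>y - x\<bar> < d x"
      using T(3) by (force simp: dist_real_def)
    then show "\<bar>f y\<bar> \<le> (\<Sum>x\<in>T. \<bar>B x\<bar>)"
      using dB(2) T(2) by (meson abs_ge_self member_le_sum abs_ge_zero order.trans)
  qed
qed

lemma piecewise_continuous_integrable_on:
  assumes pc: "piecewise_continuous f"
  shows "f integrable_on {a..b}"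
proof -
  obtain S where S: "finite S" "\<forall>x\<in>{a..b} - S. isCont f x"
    using pc unfolding piecewise_continuous_def by blast
  obtain B where B: "\<And>x. x \<in> {a..b} \<Longrightarrow> \<bar>f x\<bar> \<le> B"
    using piecewise_continuous_bounded_on[OF pc] by blast
  have neg: "negligible S"
    using S(1) by (simp add: negligible_finite)
  have meas: "{a..b} - S \<in> sets lebesgue"
    using S(1) by (simp add: finite_imp_closed sets.Diff)
  have "continuous_on ({a..b} - S) f"
    using S(2) by (simp add: continuous_at_imp_continuous_on)
  then have "f \<in> borel_measurable (lebesgue_on ({a..b} - S))"
    using continuous_imp_measurable_on_sets_lebesgue meas by blast
  moreover have "(\<lambda>_. B) integrable_on ({a..b} - S)"
    by (rule integrable_spike_set[of _ "{a..b}"]) (auto intro: negligible_subset[OF neg])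
  ultimately have "f integrable_on ({a..b} - S)"
    using measurable_bounded_by_integrable_imp_integrable_real meas B by (metis DiffD1)
  then show ?thesis
    by (rule integrable_spike_set) (auto intro: negligible_subset[OF neg])
qed

section \<open>The Hamiltonian matrix in complex coordinates\<close>

lemma vector_4 [simp]:
  "(vector [x1, x2, x3, x4] :: 'a::zero^4) $ 1 = x1"
  "(vector [x1, x2, x3, x4] :: 'a::zero^4) $ 2 = x2"
  "(vector [x1, x2, x3, x4] :: 'a::zero^4) $ 3 = x3"
  "(vector [x1, x2, x3, x4] :: 'a::zero^4) $ 4 = x4"
  unfolding vector_def by simp_all

lemma ham_matrix_vector_nth:
  "(ham_matrix b *v w) $ 1 = b * w $ 2 + w $ 3"
  "(ham_matrix b *v w) $ 2 = - b * w $ 1 + w $ 4"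
  "(ham_matrix b *v w) $ 3 = - (b\<^sup>2) * w $ 1 + b * w $ 4"
  "(ham_matrix b *v w) $ 4 = - (b\<^sup>2) * w $ 2 - b * w $ 3"
  by (simp_all add: ham_matrix_def matrix_vector_mult_def sum_4)

lemma norm_ham_matrix_vector_le:
  "norm (ham_matrix b *v w) \<le> 16 * (1 + \<bar>b\<bar> + b\<^sup>2) * norm w"
proof -
  have "\<forall>i j. \<bar>ham_matrix b $ i $ j\<bar> \<le> 1 + \<bar>b\<bar> + b\<^sup>2"
    by (simp add: forall_4 ham_matrix_def)
  then have "onorm ((*v) (ham_matrix b)) \<le> 16 * (1 + \<bar>b\<bar> + b\<^sup>2)"
    using onorm_le_matrix_component[of "ham_matrix b" "1 + \<bar>b\<bar> + b\<^sup>2"] by simp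
  then show ?thesis
    using onorm[OF matrix_vector_mul_bounded_linear, of "ham_matrix b" w]
    by (meson mult_right_mono norm_ge_zero order.trans)
qed

definition complexify :: "real^4 \<Rightarrow> complex^2" where
  "complexify w = vector [Complex (w $ 1) (w $ 2), Complex (w $ 3) (w $ 4)]"

definition i_mult :: "real^4 \<Rightarrow> real^4" where
  "i_mult w = vector [- w $ 2, w $ 1, - w $ 4, w $ 3]"

definition wronskian :: "real^4 \<Rightarrow> real^4 \<Rightarrow> complex" where
  "wronskian p q = complexify p $ 1 * complexify q $ 2 - complexify q $ 1 * complexify p $ 2"

lemma ham_matrix_i_mult: "ham_matrix b *v i_mult w = i_mult (ham_matrix b *v w)"
  by (simp add: i_mult_def vec_eq_iff forall_4 ham_matrix_vector_nth algebra_simps)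

lemma wronskian_ham_matrix:
  "wronskian (ham_matrix b *v p) q + wronskian p (ham_matrix b *v q) = - (2 * \<i> * b) * wronskian p q"
  by (simp add: wronskian_def complexify_def ham_matrix_vector_nth complex_eq_iff algebra_simps power2_eq_square)

lemma bounded_linear_complexify_nth: "bounded_linear (\<lambda>w. complexify w $ i)"
proof -
  have "\<forall>i. linear (\<lambda>w. complexify w $ i)"
    by (simp add: forall_2 complexify_def linear_iff complex_eq_iff)
  then show ?thesis
    by (simp add: linear_conv_bounded_linear)
qed

lemma wronskian_has_vector_derivative:
  assumes "(p has_vector_derivative p') (at x within S)" "(q has_vector_derivative q') (at x within S)"
  shows "((\<lambda>t. wronskian (p t) (q t)) has_vector_derivative wronskian p' (q x) + wronskian (p x) q')
    (at x within S)"
  unfolding wronskian_def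
  by (rule derivative_eq_intros bounded_linear.has_vector_derivative[OF bounded_linear_complexify_nth] assms refl)+
     (simp add: algebra_simps)

section \<open>Complex-symplectic maps with a fixed vector\<close>

definition complex_matrix :: "real^4^4 \<Rightarrow> complex^2^2" where
  "complex_matrix U = (\<chi> i j. complexify (U *v axis (if j = 1 then 1 else 3) 1) $ i)"

lemma complexify_diff: "complexify (x - y) = complexify x - complexify y"
  by (simp add: complexify_def vec_eq_iff forall_2 complex_eq_iff)

lemma complexify_0 [simp]: "complexify 0 = 0"
  by (simp add: complexify_def vec_eq_iff forall_2 complex_eq_iff)

lemma complexify_eq_iff: "complexify x = complexify y \<longleftrightarrow> x = y"
  by (auto simp: complexify_def vec_eq_iff forall_2 forall_4 complex_eq_iff)

lemma complexify_matrix_vector_mult: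
  assumes complex_linear: "\<And>w. U *v i_mult w = i_mult (U *v w)"
  shows "complexify (U *v w) = complex_matrix U *v complexify w"
proof -
  define e1 e3 :: "real^4" where "e1 = axis 1 1" and "e3 = axis 3 1"
  have "w = w $ 1 *\<^sub>R e1 + w $ 2 *\<^sub>R i_mult e1 + w $ 3 *\<^sub>R e3 + w $ 4 *\<^sub>R i_mult e3"
    by (simp add: e1_def e3_def i_mult_def axis_def vec_eq_iff forall_4)
  then have "U *v w = U *v (w $ 1 *\<^sub>R e1 + w $ 2 *\<^sub>R i_mult e1 + w $ 3 *\<^sub>R e3 + w $ 4 *\<^sub>R i_mult e3)"
    by (rule arg_cong)
  also have "\<dots> = w $ 1 *\<^sub>R (U *v e1) + w $ 2 *\<^sub>R i_mult (U *v e1)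
      + w $ 3 *\<^sub>R (U *v e3) + w $ 4 *\<^sub>R i_mult (U *v e3)"
    by (simp only: matrix_vector_right_distrib matrix_vector_mult_scaleR complex_linear)
  finally have "U *v w = w $ 1 *\<^sub>R (U *v e1) + w $ 2 *\<^sub>R i_mult (U *v e1)
      + w $ 3 *\<^sub>R (U *v e3) + w $ 4 *\<^sub>R i_mult (U *v e3)" .
  then show ?thesis
    by (simp add: complex_matrix_def complexify_def i_mult_def e1_def e3_def matrix_vector_mult_def
        sum_2 vec_eq_iff forall_2 complex_eq_iff algebra_simps)
qed

lemma wronskian_matrix_vector_mult:
  assumes "\<And>w. U *v i_mult w = i_mult (U *v w)"
  shows "wronskian (U *v p) (U *v q) = det (complex_matrix U) * wronskian p q"
  unfolding wronskian_def complexify_matrix_vector_mult[OF assms]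
  by (simp add: det_2 matrix_vector_mult_def sum_2 algebra_simps)

lemma det_one_fixed_vector_unipotent:
  fixes M :: "'a::idom^2^2"
  assumes det: "det M = 1" and fixed: "M *v x = x" and "x \<noteq> 0"
  shows "M *v (M *v y - y) = M *v y - y"
proof -
  define a b c d where "a = M $ 1 $ 1" and "b = M $ 1 $ 2" and "c = M $ 2 $ 1" and "d = M $ 2 $ 2"
  have ad_bc: "a * d - b * c = 1"
    using det by (simp add: det_2 a_def b_def c_def d_def)
  have fixed1: "(a - 1) * x $ 1 + b * x $ 2 = 0" and fixed2: "c * x $ 1 + (d - 1) * x $ 2 = 0"
    using fixed by (simp_all add: vec_eq_iff forall_2 matrix_vector_mult_def sum_2 a_def b_def c_def d_def
        algebra_simps)
  have "((a - 1) * (d - 1) - b * c) * x $ 1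
      = (d - 1) * ((a - 1) * x $ 1 + b * x $ 2) - b * (c * x $ 1 + (d - 1) * x $ 2)"
    "((a - 1) * (d - 1) - b * c) * x $ 2
      = (a - 1) * (c * x $ 1 + (d - 1) * x $ 2) - c * ((a - 1) * x $ 1 + b * x $ 2)"
    by (simp_all add: algebra_simps)
  then have "((a - 1) * (d - 1) - b * c) * x $ 1 = 0" "((a - 1) * (d - 1) - b * c) * x $ 2 = 0"
    by (simp_all add: fixed1 fixed2)
  then have "(a - 1) * (d - 1) - b * c = 0"
    using \<open>x \<noteq> 0\<close> by (auto simp: vec_eq_iff forall_2)
  then have trace: "a + d = 2"
    using ad_bc by (simp add: algebra_simps)
  \<comment> \<open>Cayley--Hamilton: \<open>(M - 1)\<^sup>2 = M\<^sup>2 - tr M \<cdot> M + det M = 0\<close>\<close>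
  have N: "(a - 1) * (a - 1) + b * c = 0" "(a - 1) * b + b * (d - 1) = 0"
    "c * (a - 1) + (d - 1) * c = 0" "c * b + (d - 1) * (d - 1) = 0"
    using ad_bc trace by algebra+
  have "(M *v (M *v y - y) - (M *v y - y)) $ 1
      = ((a - 1) * (a - 1) + b * c) * y $ 1 + ((a - 1) * b + b * (d - 1)) * y $ 2"
    "(M *v (M *v y - y) - (M *v y - y)) $ 2
      = (c * (a - 1) + (d - 1) * c) * y $ 1 + (c * b + (d - 1) * (d - 1)) * y $ 2"
    by (simp_all add: matrix_vector_mult_def sum_2 a_def b_def c_def d_def algebra_simps)
  then have "M *v (M *v y - y) - (M *v y - y) = 0"
    by (simp add: N vec_eq_iff forall_2)
  then show ?thesis
    by simp
qed

lemma complex_symplectic_fixed_vector_unipotent: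
  fixes U :: "real^4^4"
  assumes complex_linear: "\<And>w. U *v i_mult w = i_mult (U *v w)"
    and symplectic: "\<And>p q. wronskian (U *v p) (U *v q) = wronskian p q"
    and fixed: "U *v f = f" and "f \<noteq> 0"
  shows "U *v (U *v w - w) = U *v w - w"
proof -
  let ?M = "complex_matrix U"
  note complexify_U = complexify_matrix_vector_mult[OF complex_linear]
  have "wronskian (axis 1 1) (axis 3 1) = 1"
    by (simp add: wronskian_def complexify_def axis_def complex_eq_iff)
  then have "det ?M = 1"
    using symplectic[of "axis 1 1" "axis 3 1"] by (simp add: wronskian_matrix_vector_mult[OF complex_linear])
  moreover have "?M *v complexify f = complexify f"
    using fixed by (simp flip: complexify_U)
  moreover have "complexify f \<noteq> 0"
    using \<open>f \<noteq> 0\<close> complexify_eq_iff[of f 0] by simp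
  ultimately have "?M *v (?M *v complexify w - complexify w) = ?M *v complexify w - complexify w"
    by (rule det_one_fixed_vector_unipotent)
  then have "complexify (U *v (U *v w - w)) = complexify (U *v w - w)"
    by (simp add: complexify_U complexify_diff)
  then show ?thesis
    by (simp add: complexify_eq_iff)
qed

lemma unipotent_periodic_eq_id:
  fixes f :: "'a::real_vector \<Rightarrow> 'a"
  assumes "linear f" and unipotent: "\<And>y. f (f y - y) = f y - y"
    and periodic: "\<And>y. (f ^^ n) y = y" and "n > 0"
  shows "f y = y"
proof -
  have "(f ^^ k) y = y + of_nat k *\<^sub>R (f y - y)" for k
  proof (induction k)
    case (Suc k)
    have "(f ^^ Suc k) y = f y + of_nat k *\<^sub>R f (f y - y)"
      using Suc \<open>linear f\<close> by (simp add: linear_add linear_scale)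
    then show ?case
      by (simp add: unipotent algebra_simps)
  qed simp
  then have "of_nat n *\<^sub>R (f y - y) = 0"
    using periodic[of y] by simp
  then show ?thesis
    using \<open>n > 0\<close> by simp
qed

section \<open>The evolution of a periodic Hamiltonian\<close>

lemma integral_has_vector_derivative_within:
  fixes f :: "real \<Rightarrow> 'a::banach"
  assumes "f integrable_on {a..b}" "x \<in> {a..b}" "continuous (at x within {a..b}) f"
  shows "((\<lambda>t. integral {a..t} f) has_vector_derivative f x) (at x within {a..b})"
  using integral_has_vector_derivative_continuous_at[of f a b x "{}"] assms by simp

lemma continuous_ham_matrix_vector [continuous_intros]:
  assumes "continuous F b" "continuous F w"
  shows "continuous F (\<lambda>s. ham_matrix (b s) *v w s)"
proof -
  have "\<forall>i. continuous F (\<lambda>s. (ham_matrix (b s) *v w s) $ i)"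
    by (simp add: forall_4 ham_matrix_vector_nth) (intro conjI continuous_intros assms)
  then have "continuous F (\<lambda>s. \<chi> i. (ham_matrix (b s) *v w s) $ i)"
    unfolding continuous_def by (intro tendsto_vec_lambda) blast
  then show ?thesis
    by simp
qed

lemma continuous_on_wronskian [continuous_intros]:
  assumes "continuous_on S p" "continuous_on S q"
  shows "continuous_on S (\<lambda>t. wronskian (p t) (q t))"
  unfolding wronskian_def
  by (intro continuous_intros bounded_linear.continuous_on[OF bounded_linear_complexify_nth] assms)

lemma bounded_linear_matrix_vector_mult_left: "bounded_linear (\<lambda>M::real^'n^'m. M *v v)"
proof -
  have "linear (\<lambda>M::real^'n^'m. M *v v)"
    by (rule linearI) (simp_all add: matrix_vector_mult_add_rdistrib scaleR_matrix_vector_assoc)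
  then show ?thesis
    by (simp add: linear_conv_bounded_linear)
qed

locale periodic_evolution =
  fixes \<beta> :: "real \<Rightarrow> real" and u :: "real \<Rightarrow> real^4^4"
  assumes piecewise_continuous: "piecewise_continuous \<beta>"
    and periodic: "\<And>t. \<beta> (t + 1) = \<beta> t"
    and evolution: "is_evolution \<beta> u"
begin

lemma u_0: "u 0 = mat 1"
proof -
  have "((\<lambda>s. ham_matrix (\<beta> s) ** u s) has_integral (u 0 - mat 1)) {0}"
    using evolution unfolding is_evolution_def by fastforce
  then show ?thesis
    using has_integral_unique[OF _ has_integral_refl(2)] by fastforce
qed

lemma trajectory_has_integral:
  assumes "t \<ge> 0"
  shows "((\<lambda>s. ham_matrix (\<beta> s) *v (u s *v v)) has_integral (u t *v v - v)) {0..t}"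
proof -
  have "((\<lambda>s. ham_matrix (\<beta> s) ** u s) has_integral (u t - mat 1)) {0..t}"
    using evolution assms unfolding is_evolution_def by blast
  from has_integral_linear[OF this bounded_linear_matrix_vector_mult_left] show ?thesis
    by (simp add: o_def matrix_vector_mul_assoc matrix_vector_mult_diff_rdistrib)
qed

lemma integral_equation_solution_eq_0:
  assumes solves: "\<And>t. t \<ge> 0 \<Longrightarrow> ((\<lambda>s. ham_matrix (\<beta> s) *v y s) has_integral y t) {0..t}"
    and "t \<ge> 0"
  shows "y t = 0"
proof -
  obtain B where B: "\<And>s. s \<in> {0..t} \<Longrightarrow> \<bar>\<beta> s\<bar> \<le> B"
    using piecewise_continuous_bounded_on[OF piecewise_continuous] by blast
  have "B \<ge> 0"
    using B[of 0] \<open>t \<ge> 0\<close> by fastforce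
  have "norm (ham_matrix (\<beta> s) *v y s) \<le> 16 * (1 + B + B\<^sup>2) * norm (y s)" if "s \<in> {0..t}" for s
  proof -
    have "(\<beta> s)\<^sup>2 \<le> B\<^sup>2"
      using B[OF that] by (metis abs_ge_zero power2_abs power_mono)
    then have "16 * (1 + \<bar>\<beta> s\<bar> + (\<beta> s)\<^sup>2) \<le> 16 * (1 + B + B\<^sup>2)"
      using B[OF that] by simp
    then show ?thesis
      using norm_ham_matrix_vector_le[of "\<beta> s" "y s"] by (meson mult_right_mono norm_ge_zero order.trans)
  qed
  then show ?thesis
    by (intro integral_equation_unique_zero[where K = "16 * (1 + B + B\<^sup>2)"])
      (use solves \<open>t \<ge> 0\<close> \<open>B \<ge> 0\<close> in auto)
qed

lemma trajectory_has_integral_between: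
  assumes "0 \<le> a" "a \<le> b"
  shows "((\<lambda>s. ham_matrix (\<beta> s) *v (u s *v v)) has_integral (u b *v v - u a *v v)) {a..b}"
proof -
  let ?f = "\<lambda>s. ham_matrix (\<beta> s) *v (u s *v v)"
  have a: "(?f has_integral (u a *v v - v)) {0..a}"
    using trajectory_has_integral assms(1) .
  have b: "(?f has_integral (u b *v v - v)) {0..b}"
    using trajectory_has_integral assms by simp
  have "?f integrable_on {a..b}"
    by (rule integrable_subinterval_real[OF has_integral_integrable[OF b]]) (use assms in simp)
  then obtain I where I: "(?f has_integral I) {a..b}"
    by blast
  have "(u a *v v - v) + I = u b *v v - v"
    using has_integral_combine[OF assms a I] b by (rule has_integral_unique)
  then have "I = u b *v v - u a *v v"
    by (simp add: algebra_simps)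
  with I show ?thesis
    by simp
qed

lemma u_add_1:
  assumes "t \<ge> 0"
  shows "u (t + 1) *v v = u t *v (u 1 *v v)"
proof -
  let ?y = "\<lambda>t. u (t + 1) *v v - u t *v (u 1 *v v)"
  have "((\<lambda>s. ham_matrix (\<beta> s) *v ?y s) has_integral ?y t) {0..t}" if "t \<ge> 0" for t
  proof -
    have "((\<lambda>s. ham_matrix (\<beta> s) *v (u s *v v))
        has_integral (u (t + 1) *v v - u 1 *v v)) {1..t + 1}"
      using trajectory_has_integral_between that by simp
    from has_integral_shift_real_ivl[OF this, of 1]
    have shifted: "((\<lambda>s. ham_matrix (\<beta> s) *v (u (s + 1) *v v))
        has_integral (u (t + 1) *v v - u 1 *v v)) {0..t}"
      by (simp add: periodic)
    have "((\<lambda>s. ham_matrix (\<beta> s) *v (u s *v (u 1 *v v)))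
        has_integral (u t *v (u 1 *v v) - u 1 *v v)) {0..t}"
      using trajectory_has_integral that by blast
    from has_integral_diff[OF shifted this] show ?thesis
      by (simp add: matrix_vector_mult_diff_distrib)
  qed
  then show ?thesis
    using integral_equation_solution_eq_0[of ?y t] assms by simp
qed

lemma u_add_nat:
  assumes "t \<ge> 0"
  shows "u (t + real k) *v v = u t *v ((*v) (u 1) ^^ k) v"
proof (induction k arbitrary: v)
  case (Suc k)
  have "u (t + real (Suc k)) *v v = u (t + real k + 1) *v v"
    by (simp add: algebra_simps)
  also have "\<dots> = u (t + real k) *v (u 1 *v v)"
    using u_add_1 assms by simp
  also have "\<dots> = u t *v ((*v) (u 1) ^^ Suc k) v"
    by (simp add: Suc funpow_Suc_right del: funpow.simps)
  finally show ?case .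
qed simp

lemma u_i_mult:
  assumes "t \<ge> 0"
  shows "u t *v i_mult v = i_mult (u t *v v)"
proof -
  let ?y = "\<lambda>t. u t *v i_mult v - i_mult (u t *v v)"
  have "((\<lambda>s. ham_matrix (\<beta> s) *v ?y s) has_integral ?y t) {0..t}" if "t \<ge> 0" for t
  proof -
    have lin: "linear i_mult"
      by (simp add: linear_iff i_mult_def vec_eq_iff forall_4)
    have a: "((\<lambda>s. ham_matrix (\<beta> s) *v (u s *v i_mult v))
        has_integral (u t *v i_mult v - i_mult v)) {0..t}"
      using trajectory_has_integral that .
    have b: "((\<lambda>s. ham_matrix (\<beta> s) *v i_mult (u s *v v))
        has_integral (i_mult (u t *v v) - i_mult v)) {0..t}"
      using has_integral_linear[OF trajectory_has_integral[OF that] linear_conv_bounded_linear[THEN iffD1, OF lin]]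
      by (simp add: o_def ham_matrix_i_mult linear_diff[OF lin])
    from has_integral_diff[OF a b] show ?thesis
      by (simp add: matrix_vector_mult_diff_distrib)
  qed
  then show ?thesis
    using integral_equation_solution_eq_0[of ?y t] assms by simp
qed

lemma trajectory_continuous_on: "continuous_on {0..T} (\<lambda>t. u t *v v)"
proof (cases "T \<ge> 0")
  case True
  let ?f = "\<lambda>s. ham_matrix (\<beta> s) *v (u s *v v)"
  have "u t *v v = v + integral {0..t} ?f" if "t \<in> {0..T}" for t
    using integral_unique[OF trajectory_has_integral[of t]] that by simp
  moreover have "continuous_on {0..T} (\<lambda>t. v + integral {0..t} ?f)"
    using trajectory_has_integral True by (intro continuous_intros indefinite_integral_continuous_1) blast
  ultimately show ?thesis
    by (metis (no_types, lifting) continuous_on_cong)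
qed simp

lemma trajectory_has_vector_derivative:
  assumes "x \<in> {0..T}" "isCont \<beta> x"
  shows "((\<lambda>t. u t *v v) has_vector_derivative ham_matrix (\<beta> x) *v (u x *v v)) (at x within {0..T})"
proof -
  let ?f = "\<lambda>s. ham_matrix (\<beta> s) *v (u s *v v)"
  have "continuous (at x within {0..T}) (\<lambda>t. u t *v v)"
    using trajectory_continuous_on assms(1) by (simp add: continuous_on_eq_continuous_within)
  moreover have "continuous (at x within {0..T}) \<beta>"
    using assms(2) by (rule continuous_at_imp_continuous_at_within)
  ultimately have "continuous (at x within {0..T}) ?f"
    by (intro continuous_intros)
  moreover have "?f integrable_on {0..T}"
    using trajectory_has_integral[of T] assms(1) by auto
  ultimately have "((\<lambda>t. v + integral {0..t} ?f) has_vector_derivative ?f x) (at x within {0..T})"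
    using assms(1) by (auto intro!: derivative_eq_intros integral_has_vector_derivative_within)
  moreover have "u t *v v = v + integral {0..t} ?f" if "t \<in> {0..T}" for t
    using integral_unique[OF trajectory_has_integral[of t]] that by simp
  ultimately show ?thesis
    by (rule has_vector_derivative_transform[OF assms(1), rotated])
qed

lemma wronskian_u_1:
  assumes mean_zero: "integral {0..1} \<beta> = 0"
  shows "wronskian (u 1 *v p) (u 1 *v q) = wronskian p q"
proof -
  obtain S where S: "finite S" "\<forall>x\<in>{0..1} - S. isCont \<beta> x"
    using piecewise_continuous unfolding piecewise_continuous_def by blast
  define \<theta> where "\<theta> t = integral {0..t} \<beta>" for t
  \<comment> \<open>the constant Wronskian of the rotating frame, expressed in the original coordinates\<close>
  define V where "V t = exp (2 * \<i> * \<theta> t) * wronskian (u t *v p) (u t *v q)" for t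
  have \<beta>_integrable: "\<beta> integrable_on {0..1}"
    by (rule piecewise_continuous_integrable_on[OF piecewise_continuous])
  have "(V has_vector_derivative 0) (at x within {0..1})" if x: "x \<in> {0..1} - S" for x
  proof -
    have x01: "x \<in> {0..1}" and cont: "isCont \<beta> x"
      using x S by auto
    have "continuous (at x within {0..1}) \<beta>"
      using cont by (rule continuous_at_imp_continuous_at_within)
    then have "(\<theta> has_vector_derivative \<beta> x) (at x within {0..1})"
      unfolding \<theta>_def by (rule integral_has_vector_derivative_within[OF \<beta>_integrable x01])
    then have "((\<lambda>t. 2 * \<i> * \<theta> t) has_vector_derivative 2 * \<i> * \<beta> x) (at x within {0..1})"
      unfolding has_real_derivative_iff_has_vector_derivative[symmetric]
      by (auto intro!: derivative_eq_intros)
    then have E: "((\<lambda>t. exp (2 * \<i> * \<theta> t)) has_vector_derivative 2 * \<i> * \<beta> x * exp (2 * \<i> * \<theta> x))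
        (at x within {0..1})"
      using field_vector_diff_chain_within[OF _ DERIV_exp[THEN has_field_derivative_at_within]]
      by (simp add: o_def)
    have W: "((\<lambda>t. wronskian (u t *v p) (u t *v q)) has_vector_derivative
        - (2 * \<i> * \<beta> x) * wronskian (u x *v p) (u x *v q)) (at x within {0..1})"
      using wronskian_has_vector_derivative[OF trajectory_has_vector_derivative[OF x01 cont]
          trajectory_has_vector_derivative[OF x01 cont]]
      by (simp add: wronskian_ham_matrix)
    from has_vector_derivative_mult[OF E W] show ?thesis
      unfolding V_def by (simp add: algebra_simps)
  qed
  moreover have "continuous_on {0..1} V"
    unfolding V_def \<theta>_def
    by (intro continuous_intros trajectory_continuous_on indefinite_integral_continuous_1 \<beta>_integrable)
  ultimately have "V 1 = V 0"
    by (intro has_derivative_zero_unique_strong_interval[OF S(1)])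
      (auto simp: has_vector_derivative_def)
  moreover have "\<theta> 0 = 0" "\<theta> 1 = 0"
    using mean_zero by (simp_all add: \<theta>_def)
  ultimately show ?thesis
    by (simp add: V_def u_0)
qed

lemma integral_over_periods:
  "((\<lambda>t. u t *v v) has_integral integral {0..1} (\<lambda>t. u t *v (\<Sum>k<m. ((*v) (u 1) ^^ k) v))) {0..real m}"
proof (induction m)
  case 0
  show ?case
    using has_integral_refl(2)[of "\<lambda>t. u t *v v" 0] by simp
next
  case (Suc m)
  let ?w = "((*v) (u 1) ^^ m) v"
  have integrable: "(\<lambda>t. u t *v w) integrable_on {0..1}" for w
    by (rule integrable_continuous_interval[OF trajectory_continuous_on])
  have "((\<lambda>t. u t *v ?w) has_integral integral {0..1} (\<lambda>t. u t *v ?w)) {0..1}"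
    using integrable by (rule integrable_integral)
  then have "((\<lambda>t. u (t + real m) *v v) has_integral integral {0..1} (\<lambda>t. u t *v ?w)) {0..1}"
    by (rule has_integral_eq[rotated]) (simp add: u_add_nat)
  from has_integral_shift_real_ivl[OF this, of "- real m"]
  have "((\<lambda>t. u t *v v) has_integral integral {0..1} (\<lambda>t. u t *v ?w)) {real m..real (Suc m)}"
    by simp
  from has_integral_combine[OF _ _ Suc this]
  show ?case
    by (simp add: matrix_vector_right_distrib integral_add[OF integrable integrable, symmetric])
qed

lemma loop_trajectory_has_integral_zero:
  assumes mean_zero: "integral {0..1} \<beta> = 0"
    and closes: "u (real n) = mat 1" and "n > 0" and not_closed: "u 1 \<noteq> mat 1"
  shows "((\<lambda>t. u t *v v) has_integral 0) {0..real n}"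
proof -
  let ?U = "u 1"
  have periodic: "((*v) ?U ^^ n) w = w" for w
    using u_add_nat[of 0 n w] closes by (simp add: u_0)
  define s where "s = (\<Sum>k<n. ((*v) ?U ^^ k) v)"
  have "?U *v s = (\<Sum>k<n. ((*v) ?U ^^ Suc k) v)"
    unfolding s_def by (simp add: linear_sum[OF matrix_vector_mul_linear])
  also have "\<dots> = s"
    using sum.lessThan_Suc_shift[of "\<lambda>k. ((*v) ?U ^^ k) v" n] periodic[of v]
    by (simp add: s_def)
  finally have fixed: "?U *v s = s" .
  have "s = 0"
  proof (rule ccontr)
    assume "s \<noteq> 0"
    then have "?U *v (?U *v w - w) = ?U *v w - w" for w
      using complex_symplectic_fixed_vector_unipotent[OF u_i_mult wronskian_u_1[OF mean_zero] fixed] by simp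
    then have "?U *v w = w" for w
      using unipotent_periodic_eq_id[OF matrix_vector_mul_linear _ periodic \<open>n > 0\<close>] by blast
    then show False
      using not_closed by (simp add: matrix_eq)
  qed
  then show ?thesis
    using integral_over_periods[of v n] by (simp add: s_def)
qed

end

theorem proposition3:
  fixes \<beta> :: "real \<Rightarrow> real" and u :: "real \<Rightarrow> real^4^4" and n :: nat
  assumes pc: "piecewise_continuous \<beta>"
    and per: "\<forall>t. \<beta> (t + 1) = \<beta> t"
    and zero_int: "\<forall>k::int. \<beta> (of_int k) = 0"
    and mean_zero: "integral {0..1} \<beta> = 0"
    and evol: "is_evolution \<beta> u"
    and n_gt: "n > 1"
    and closes: "u (real n) = mat 1"
    and first: "\<forall>j::nat. 1 \<le> j \<and> j < n \<longrightarrow> u (real j) \<noteq> mat 1"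
  shows "\<forall>v :: real^4.
           (1 / real n) *\<^sub>R integral {0..real n} (\<lambda>t. vector [(u t *v v) $ 1, (u t *v v) $ 2] :: real^2) = 0"
proof
  fix v :: "real^4"
  interpret periodic_evolution \<beta> u
    using pc per evol by unfold_locales auto
  have "((\<lambda>t. u t *v v) has_integral 0) {0..real n}"
    using loop_trajectory_has_integral_zero[OF mean_zero closes] n_gt first by auto
  moreover have "linear (\<lambda>w :: real^4. vector [w $ 1, w $ 2] :: real^2)"
    by (rule linearI) (simp_all add: vec_eq_iff forall_2)
  ultimately have "((\<lambda>t. vector [(u t *v v) $ 1, (u t *v v) $ 2] :: real^2) has_integral vector [0, 0])
      {0..real n}"
    using has_integral_linear[of "\<lambda>t. u t *v v" 0 "{0..real n}" "\<lambda>w :: real^4. vector [w $ 1, w $ 2] :: real^2"]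
    by (simp add: linear_conv_bounded_linear o_def)
  moreover have "vector [0, 0] = (0 :: real^2)"
    by (simp add: vec_eq_iff forall_2)
  ultimately show "(1 / real n) *\<^sub>R integral {0..real n} (\<lambda>t. vector [(u t *v v) $ 1, (u t *v v) $ 2] :: real^2) = 0"
    by (simp add: integral_unique)
qed

end
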